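(* Let $C$ be a commutative ring with unity, let $n \geq 2$, and let $\mathcal{T}_n(C)$ be the $C$-algebra of $n\times n$ upper triangular matrices over $C$. Then every Jordan derivation $D:\mathcal{T}_n(C)\to\mathcal{T}_n(C)$ is a derivation.
   Context: Let $T$ be an algebra over a commutative ring $C$ with unity. A map $D:T\to T$ is a Jordan derivation if it is $C$-linear and $D(a^2)=D(a)a+aD(a)$ for all $a\in T$. A $C$-linear map $D:T\to T$ is a derivation if $D(ab)=D(a)b+aD(b)$ for all $a,b\in T$. The ring $C$ is not assumed to be $2$-torsion free. *)

theory Defs
  imports "Jordan_Normal_Form.Matrix" "HOL-Library.FuncSet"
begin

definition upper_triangular_mats :: "nat \<Rightarrow> 'a::comm_ring_1 mat set" where
  "upper_triangular_mats n = {A \<in> carrier_mat n n. upper_triangular A}"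

text \<open>
  The algebra \<open>T\<close> is given by its underlying set of matrices, with the matrix operations and
  the whole type \<open>'a\<close> as ring of scalars. Maps are HOL functions on all matrices; only their
  values on \<open>T\<close> matter.
\<close>

definition linear_self_map :: "'a::comm_ring_1 mat set \<Rightarrow> ('a mat \<Rightarrow> 'a mat) \<Rightarrow> bool" where
  "linear_self_map T D \<longleftrightarrow>
     D \<in> T \<rightarrow> T \<and>
     (\<forall>A\<in>T. \<forall>B\<in>T. D (A + B) = D A + D B) \<and>
     (\<forall>c. \<forall>A\<in>T. D (c \<cdot>\<^sub>m A) = c \<cdot>\<^sub>m D A)"

definition jordan_derivation :: "'a::comm_ring_1 mat set \<Rightarrow> ('a mat \<Rightarrow> 'a mat) \<Rightarrow> bool" where
  "jordan_derivation T D \<longleftrightarrow>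
     linear_self_map T D \<and> (\<forall>A\<in>T. D (A * A) = D A * A + A * D A)"

definition derivation :: "'a::comm_ring_1 mat set \<Rightarrow> ('a mat \<Rightarrow> 'a mat) \<Rightarrow> bool" where
  "derivation T D \<longleftrightarrow>
     linear_self_map T D \<and> (\<forall>A\<in>T. \<forall>B\<in>T. D (A * B) = D A * B + A * D B)"

end

(*
  Every Jordan derivation D of the upper triangular matrices is inner. Let E i j be the matrix
  units. Comparing entries in the linearised identity for the pairs (E i i, E i j) and
  (E j j, E i j) determines all entries of D (E i j) except the (i, j) entry in terms of the
  off-diagonal matrix V with V(k, l) = D (E l l)(k, l); triangularity kills the terms that would
  otherwise be controlled only up to 2-torsion. The remaining coefficients satisfy
  d(i, j) + d(j, k) = d(i, k), so d(i, j) = d(0, j) - d(0, i), and putting -d(0, k) on the diagonal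
  of V gives D X = V X - X V on matrix units, hence everywhere.
*)
theory Submission
  imports Defs
begin

section \<open>Matrix units\<close>

text \<open>Rows and columns count from 0. A position outside the matrix is allowed and gives the
  zero matrix, so facts such as \<open>unit_mat_upper\<close> need no bound on the indices.\<close>

definition unit_mat :: "nat \<Rightarrow> nat \<Rightarrow> nat \<Rightarrow> 'a::comm_ring_1 mat" where
  "unit_mat n i j = mat n n (\<lambda>(k, l). if k = i \<and> l = j then 1 else 0)"

lemma unit_mat_carrier [simp]: "unit_mat n i j \<in> carrier_mat n n"
  by (simp add: unit_mat_def)

lemma unit_mat_dim [simp]: "dim_row (unit_mat n i j) = n" "dim_col (unit_mat n i j) = n"
  by (simp_all add: unit_mat_def)

lemma unit_mat_index [simp]:
  "k < n \<Longrightarrow> l < n \<Longrightarrow> unit_mat n i j $$ (k, l) = (if k = i \<and> l = j then 1 else 0)"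
  by (simp add: unit_mat_def)

lemma mult_mat_index_sum:
  assumes "A \<in> carrier_mat n n" "B \<in> carrier_mat n n" "k < n" "l < n"
  shows "(A * B) $$ (k, l) = (\<Sum>m<n. A $$ (k, m) * B $$ (m, l))"
  using assms by (auto simp: scalar_prod_def atLeast0LessThan intro!: sum.cong)

lemma mult_unit_mat_index:
  assumes "A \<in> carrier_mat n n" "i < n" "k < n" "l < n"
  shows "(A * unit_mat n i j) $$ (k, l) = (if l = j then A $$ (k, i) else 0)"
proof -
  have "(A * unit_mat n i j) $$ (k, l) = (\<Sum>m<n. A $$ (k, m) * unit_mat n i j $$ (m, l))"
    using assms by (intro mult_mat_index_sum) auto
  also have "\<dots> = (\<Sum>m<n. if m = i then if l = j then A $$ (k, i) else 0 else 0)"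
    using assms by (intro sum.cong) auto
  finally show ?thesis
    using assms by simp
qed

lemma unit_mat_mult_index:
  assumes "A \<in> carrier_mat n n" "j < n" "k < n" "l < n"
  shows "(unit_mat n i j * A) $$ (k, l) = (if k = i then A $$ (j, l) else 0)"
proof -
  have "(unit_mat n i j * A) $$ (k, l) = (\<Sum>m<n. unit_mat n i j $$ (k, m) * A $$ (m, l))"
    using assms by (intro mult_mat_index_sum) auto
  also have "\<dots> = (\<Sum>m<n. if m = j then if k = i then A $$ (j, l) else 0 else 0)"
    using assms by (intro sum.cong) auto
  finally show ?thesis
    using assms by simp
qed

lemma unit_mat_mult_unit_mat:
  assumes "j < n" "p < n"
  shows "unit_mat n i j * unit_mat n p q = (if j = p then unit_mat n i q else 0\<^sub>m n n)"
  using assms by (intro eq_matI)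
    (auto simp: mult_unit_mat_index simp del: index_mult_mat(1) split: if_splits)

section \<open>The algebra of upper triangular matrices\<close>

lemma upper_triangular_mats_carrier:
  "A \<in> upper_triangular_mats n \<Longrightarrow> A \<in> carrier_mat n n"
  by (simp add: upper_triangular_mats_def)

lemma upper_triangular_mats_lower:
  "A \<in> upper_triangular_mats n \<Longrightarrow> l < k \<Longrightarrow> k < n \<Longrightarrow> A $$ (k, l) = 0"
  by (auto simp: upper_triangular_mats_def)

lemma upper_triangular_matsI:
  assumes "A \<in> carrier_mat n n" "\<And>k l. l < k \<Longrightarrow> k < n \<Longrightarrow> A $$ (k, l) = 0"
  shows "A \<in> upper_triangular_mats n"
  using assms by (auto simp: upper_triangular_mats_def)

lemma unit_mat_upper: "i \<le> j \<Longrightarrow> unit_mat n i j \<in> upper_triangular_mats n"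
  by (intro upper_triangular_matsI) auto

lemma upper_triangular_mats_zero: "0\<^sub>m n n \<in> upper_triangular_mats n"
  by (intro upper_triangular_matsI) auto

lemma upper_triangular_mats_add:
  assumes "A \<in> upper_triangular_mats n" "B \<in> upper_triangular_mats n"
  shows "A + B \<in> upper_triangular_mats n"
  using assms[THEN upper_triangular_mats_carrier] assms[THEN upper_triangular_mats_lower]
  by (intro upper_triangular_matsI) auto

lemma upper_triangular_mats_smult:
  assumes "A \<in> upper_triangular_mats n"
  shows "c \<cdot>\<^sub>m A \<in> upper_triangular_mats n"
  using assms[THEN upper_triangular_mats_carrier] assms[THEN upper_triangular_mats_lower]
  by (intro upper_triangular_matsI) auto

lemma upper_triangular_mats_mult:
  assumes A: "A \<in> upper_triangular_mats n" and B: "B \<in> upper_triangular_mats n"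
  shows "A * B \<in> upper_triangular_mats n"
proof (rule upper_triangular_matsI)
  note carr = A[THEN upper_triangular_mats_carrier] B[THEN upper_triangular_mats_carrier]
  show "A * B \<in> carrier_mat n n"
    using carr by simp
  fix k l assume kl: "l < k" "k < n"
  \<comment> \<open>Because \<open>l < k\<close>, each \<open>m\<close> satisfies
    \<open>m < k\<close> or \<open>l < m\<close>, so one of the two factors lies below its
    diagonal.\<close>
  have "A $$ (k, m) * B $$ (m, l) = 0" if "m < n" for m
    using kl that upper_triangular_mats_lower[OF A, of m k] upper_triangular_mats_lower[OF B, of l m]
    by (cases "m < k") auto
  then show "(A * B) $$ (k, l) = 0"
    using kl carr by (subst mult_mat_index_sum[where n = n]) auto
qed

section \<open>Linear extension from matrix units\<close>

text \<open>The matrix units \<open>unit_mat n i j\<close> with \<open>i \<le> j\<close> span the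
  algebra. \<open>F\<close> is to be the commutator with a fixed matrix, whose linearity is
  available on all square matrices.\<close>

lemma linear_self_map_eqI:
  assumes D: "linear_self_map (upper_triangular_mats n) D"
    and F0: "F (0\<^sub>m n n) = 0\<^sub>m n n"
    and Fadd: "\<And>A B. A \<in> carrier_mat n n \<Longrightarrow> B \<in> carrier_mat n n \<Longrightarrow> F (A + B) = F A + F B"
    and Fsmult: "\<And>c A. A \<in> carrier_mat n n \<Longrightarrow> F (c \<cdot>\<^sub>m A) = c \<cdot>\<^sub>m F A"
    and units: "\<And>i j. i \<le> j \<Longrightarrow> j < n \<Longrightarrow> D (unit_mat n i j) = F (unit_mat n i j)"
    and A: "A \<in> upper_triangular_mats n"
  shows "D A = F A"
proof -
  let ?T = "upper_triangular_mats n"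
  have D_add: "D (A + B) = D A + D B" if "A \<in> ?T" "B \<in> ?T" for A B
    using D that by (auto simp: linear_self_map_def)
  have D_smult: "D (c \<cdot>\<^sub>m A) = c \<cdot>\<^sub>m D A" if "A \<in> ?T" for c A
    using D that by (auto simp: linear_self_map_def)
  have D_carrier: "D A \<in> carrier_mat n n" if "A \<in> ?T" for A
    using D that upper_triangular_mats_carrier by (auto simp: linear_self_map_def)
  have D0: "D (0\<^sub>m n n) = 0\<^sub>m n n"
  proof -
    have "D (0\<^sub>m n n) = D (0 \<cdot>\<^sub>m 0\<^sub>m n n)"
      by simp
    also have "\<dots> = 0 \<cdot>\<^sub>m D (0\<^sub>m n n)"
      by (simp add: D_smult upper_triangular_mats_zero del: smult_zero_mat)
    also have "\<dots> = 0\<^sub>m n n"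
      using D_carrier[OF upper_triangular_mats_zero] by (intro eq_matI) auto
    finally show ?thesis .
  qed
  \<comment> \<open>Induction on a finite set \<open>S\<close> of positions outside which
    \<open>A\<close> vanishes; \<open>A\<close> varies, since the step passes to another
    matrix.\<close>
  have "D A = F A" if "finite S" "S \<subseteq> {(i, j). i \<le> j \<and> j < n}" "A \<in> ?T"
    "\<And>k l. k < n \<Longrightarrow> l < n \<Longrightarrow> (k, l) \<notin> S \<Longrightarrow> A $$ (k, l) = 0" for S A
    using that
  proof (induction S arbitrary: A rule: finite_induct)
    case empty
    then have "A = 0\<^sub>m n n"
      using upper_triangular_mats_carrier[of A n] by (intro eq_matI) auto
    then show ?case
      by (simp add: D0 F0)
  next
    case (insert x S)
    obtain i j where x: "x = (i, j)" by force
    with insert.prems have ij: "i \<le> j" "j < n" by auto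
    define c where "c = A $$ (i, j)"
    \<comment> \<open>Clearing the entry at the new position \<open>x\<close> leaves a matrix
      supported in the smaller set, to which the induction hypothesis applies.\<close>
    define B where "B = A + (- c) \<cdot>\<^sub>m unit_mat n i j"
    note U = unit_mat_upper[OF ij(1), of n]
    have B: "B \<in> ?T"
      unfolding B_def using insert.prems(2) U
      by (intro upper_triangular_mats_add upper_triangular_mats_smult)
    have carr: "A \<in> carrier_mat n n" "B \<in> carrier_mat n n"
      using insert.prems(2) B by (simp_all add: upper_triangular_mats_carrier)
    have "D B = F B"
    proof (rule insert.IH)
      show "B $$ (k, l) = 0" if "k < n" "l < n" "(k, l) \<notin> S" for k l
        using that carr insert.prems(3)[of k l] by (auto simp: B_def c_def x)
    qed (use insert.prems(1) B in auto)
    moreover have "A = B + c \<cdot>\<^sub>m unit_mat n i j"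
      using carr by (intro eq_matI) (auto simp: B_def)
    moreover have "D (B + c \<cdot>\<^sub>m unit_mat n i j) = D B + c \<cdot>\<^sub>m D (unit_mat n i j)"
      using D_add[OF B upper_triangular_mats_smult[OF U]] D_smult[OF U] by simp
    ultimately show ?case
      using carr by (simp add: Fadd Fsmult units[OF ij])
  qed
  moreover have "finite {(i, j). i \<le> j \<and> j < n}"
    by (rule finite_subset[of _ "{..<n} \<times> {..<n}"]) auto
  moreover have "A $$ (k, l) = 0" if "k < n" "l < n" "(k, l) \<notin> {(i, j). i \<le> j \<and> j < n}" for k l
    using that by (intro upper_triangular_mats_lower[OF A]) auto
  ultimately show ?thesis
    using A by blast
qed

section \<open>The linearised Jordan identity and innerness\<close>

text \<open>Apply the Jordan identity to \<open>A + B\<close> and cancel its instances at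
  \<open>A\<close> and \<open>B\<close>. Working entrywise puts this cancellation in the commutative
  ring of scalars, and no division by 2 occurs.\<close>

lemma jordan_derivation_linearized:
  assumes D: "jordan_derivation (upper_triangular_mats n) D"
    and A: "A \<in> upper_triangular_mats n" and B: "B \<in> upper_triangular_mats n"
    and kl: "k < n" "l < n"
  shows "D (A * B + B * A) $$ (k, l) =
    (D A * B) $$ (k, l) + (A * D B) $$ (k, l) + (D B * A) $$ (k, l) + (B * D A) $$ (k, l)"
proof -
  let ?T = "upper_triangular_mats n"
  have D_add: "D (A + B) = D A + D B" if "A \<in> ?T" "B \<in> ?T" for A B
    using D that by (auto simp: jordan_derivation_def linear_self_map_def)
  have D_sq: "D (A * A) = D A * A + A * D A" if "A \<in> ?T" for A
    using D that by (auto simp: jordan_derivation_def)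
  have D_carrier: "D A \<in> carrier_mat n n" if "A \<in> ?T" for A
    using D that upper_triangular_mats_carrier
    by (auto simp: jordan_derivation_def linear_self_map_def)
  note T = A B upper_triangular_mats_mult[OF A B] upper_triangular_mats_mult[OF B A]
    upper_triangular_mats_mult[OF A A] upper_triangular_mats_mult[OF B B]
  note carr = T[THEN upper_triangular_mats_carrier] T[THEN D_carrier]
  have "(A + B) * (A + B) = A * A + (A * B + B * A) + B * B"
    using carr by (intro eq_matI)
      (simp_all add: add_mult_distrib_mat[where nr = n and n = n and nc = n]
        mult_add_distrib_mat[where nr = n and n = n and nc = n])
  then have "D (A * A) + D (A * B + B * A) + D (B * B) = D (A + B) * (A + B) + (A + B) * D (A + B)"
    using T D_sq[of "A + B"] by (simp add: D_add upper_triangular_mats_add)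
  then have "(D (A * A) + D (A * B + B * A) + D (B * B)) $$ (k, l) =
      (D (A + B) * (A + B) + (A + B) * D (A + B)) $$ (k, l)"
    by (rule arg_cong)
  moreover have "D (A * B + B * A) \<in> carrier_mat n n"
    using T by (intro D_carrier upper_triangular_mats_add)
  ultimately show ?thesis
    using carr kl T
    by (simp add: D_add D_sq add_mult_distrib_mat[where nr = n and n = n and nc = n]
        mult_add_distrib_mat[where nr = n and n = n and nc = n] algebra_simps del: index_mult_mat(1))
qed

theorem jordan_derivation_inner:
  fixes D :: "'a::comm_ring_1 mat \<Rightarrow> 'a mat"
  assumes D: "jordan_derivation (upper_triangular_mats n) D"
  obtains V where "V \<in> carrier_mat n n" "\<And>A. A \<in> upper_triangular_mats n \<Longrightarrow> D A = V * A - A * V"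
proof -
  let ?T = "upper_triangular_mats n"
  let ?E = "unit_mat n"
  define d where "d i j k l = D (?E i j) $$ (k, l)" for i j k l
  have lin: "linear_self_map ?T D"
    using D by (simp add: jordan_derivation_def)
  have D_upper: "D A \<in> ?T" if "A \<in> ?T" for A
    using lin that by (auto simp: linear_self_map_def)
  have D_carrier: "D A \<in> carrier_mat n n" if "A \<in> ?T" for A
    using D_upper[OF that] by (rule upper_triangular_mats_carrier)
  have DE: "D (?E i j) \<in> carrier_mat n n" if "i \<le> j" for i j
    by (intro D_carrier unit_mat_upper that)
  have D0: "D (0\<^sub>m n n) $$ (k, l) = 0" if "k < n" "l < n" for k l
  proof -
    have "D (0\<^sub>m n n + 0\<^sub>m n n) = D (0\<^sub>m n n) + D (0\<^sub>m n n)"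
      using lin upper_triangular_mats_zero unfolding linear_self_map_def by blast
    then have "D (0\<^sub>m n n) $$ (k, l) = (D (0\<^sub>m n n) + D (0\<^sub>m n n)) $$ (k, l)"
      by simp
    then show ?thesis
      using that D_carrier[OF upper_triangular_mats_zero] by simp
  qed
  have d_lower: "d i j k l = 0" if "i \<le> j" "l < k" "k < n" for i j k l
    unfolding d_def
    by (rule upper_triangular_mats_lower[OF D_upper[OF unit_mat_upper[OF that(1)]] that(2,3)])
  \<comment> \<open>The Jordan identity itself at the idempotent \<open>?E i i\<close>. Linearising
    with two equal arguments would give only twice this equation.\<close>
  have d_idem: "d i i k l = (if l = i then d i i k i else 0) + (if k = i then d i i i l else 0)"
    if "i < n" "k < n" "l < n" for i k l
  proof -
    have "D (?E i i * ?E i i) = D (?E i i) * ?E i i + ?E i i * D (?E i i)"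
      using D unit_mat_upper[of i i n] by (auto simp: jordan_derivation_def)
    then have "D (?E i i) = D (?E i i) * ?E i i + ?E i i * D (?E i i)"
      using that by (simp add: unit_mat_mult_unit_mat)
    then have "d i i k l = (D (?E i i) * ?E i i + ?E i i * D (?E i i)) $$ (k, l)"
      unfolding d_def by (rule arg_cong)
    then show ?thesis
      using that DE[of i i] by (simp add: mult_unit_mat_index unit_mat_mult_index d_def
          del: index_mult_mat(1))
  qed
  \<comment> \<open>The four terms of the linearised identity in order. A factor
    \<open>?E i j\<close> on the right moves column \<open>i\<close> to column \<open>j\<close>, and
    one on the left moves row \<open>j\<close> to row \<open>i\<close>; all else becomes
    zero.\<close>
  have d_pair: "D (?E i j * ?E p q + ?E p q * ?E i j) $$ (k, l) =
      (if l = q then d i j k p else 0) + (if k = i then d p q j l else 0) +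
      (if l = j then d p q k i else 0) + (if k = p then d i j q l else 0)"
    if "i \<le> j" "j < n" "p \<le> q" "q < n" "k < n" "l < n" for i j p q k l
    using that DE[of i j] DE[of p q]
    by (subst jordan_derivation_linearized[OF D])
      (simp_all add: unit_mat_upper mult_unit_mat_index unit_mat_mult_index d_def
        del: index_mult_mat(1))
  have d_off: "d i i k l = 0" if "i < n" "k < n" "l < n" "k \<noteq> i" "l \<noteq> i" for i k l
    using d_idem[of i k l] that by simp
  \<comment> \<open>At this entry both terms of \<open>d_idem\<close> are present, so it equals its
    own double and vanishes over any ring.\<close>
  have d_diag: "d i i i i = 0" if "i < n" for i
    using d_idem[of i i i] that by simp
  \<comment> \<open>The orthogonal idempotents \<open>?E k k\<close> and \<open>?E l l\<close> have
    both products zero.\<close>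
  have d_swap: "d l l k l = - d k k k l" if "k < n" "l < n" "k \<noteq> l" for k l
    using d_pair[of k k l l k l] that by (simp add: unit_mat_mult_unit_mat D0 add_eq_0_iff)
  have d_left: "d i j k l = (if l = j then d i i k i else 0) +
      (if k = i then d i j i l else 0) + (if l = i then d i j k i else 0)"
    if "i < j" "j < n" "k < n" "l < n" for i j k l
  proof -
    \<comment> \<open>This is the fourth term of \<open>d_pair\<close> for \<open>?E i i\<close> and
      \<open>?E i j\<close>. For \<open>l = i\<close> the entry lies below the diagonal; otherwise
      it avoids row and column \<open>i\<close>.\<close>
    have "d i i j l = 0"
      using that d_lower[of i i l j] d_off[of i j l] by (cases "l = i") auto
    then show ?thesis
      using d_pair[of i i i j k l] that DE[of i j]
      by (auto simp: unit_mat_mult_unit_mat d_def[symmetric])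
  qed
  have d_right: "d i j k l = (if k = i then d j j j l else 0) +
      (if k = j then d i j j l else 0) + (if l = j then d i j k j else 0)"
    if "i < j" "j < n" "k < n" "l < n" for i j k l
  proof -
    \<comment> \<open>The mirror image: the third term for \<open>?E i j\<close> and
      \<open>?E j j\<close> is below the diagonal for \<open>k = j\<close> and avoids row and column
      \<open>j\<close> otherwise.\<close>
    have "d j j k i = 0"
      using that d_lower[of j j i k] d_off[of j k i] by (cases "k = j") auto
    then show ?thesis
      using d_pair[of i j j j k l] that DE[of i j]
      by (auto simp: unit_mat_mult_unit_mat d_def[symmetric])
  qed
  have d_cocycle: "d i k i k = d i j i j + d j k j k" if "i < j" "j < k" "k < n" for i j k
    using d_pair[of i j j k i k] that DE[of i k]
    by (auto simp: unit_mat_mult_unit_mat d_def[symmetric])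
  \<comment> \<open>Off the diagonal, \<open>V\<close> is forced by column \<open>l\<close> of the
    commutator with \<open>?E l l\<close>. The diagonal is determined only up to a common scalar,
    here fixed by \<open>V $$ (0, 0) = 0\<close>.\<close>
  define V where "V = mat n n (\<lambda>(k, l). if k = l then - d 0 k 0 k else d l l k l)"
  have V: "V \<in> carrier_mat n n"
    by (simp add: V_def)
  have V_index: "V $$ (k, l) = (if k = l then - d 0 k 0 k else d l l k l)" if "k < n" "l < n" for k l
    using that by (simp add: V_def)
  have D_unit: "D (?E i j) = V * ?E i j - ?E i j * V" if ij: "i \<le> j" "j < n" for i j
  proof (rule eq_matI)
    fix k l assume "k < dim_row (V * ?E i j - ?E i j * V)" "l < dim_col (V * ?E i j - ?E i j * V)"
    then have kl: "k < n" "l < n" using V by simp_all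
    have rhs: "(V * ?E i j - ?E i j * V) $$ (k, l) =
        (if l = j then V $$ (k, i) else 0) - (if k = i then V $$ (j, l) else 0)"
      using V ij kl by (simp add: mult_unit_mat_index unit_mat_mult_index del: index_mult_mat(1))
    have "d i j k l = (if l = j then V $$ (k, i) else 0) - (if k = i then V $$ (j, l) else 0)"
    proof (cases "i = j")
      case True
      then show ?thesis
        using ij kl d_off[of i k l] d_diag[of i] d_swap[of k l] by (auto simp: V_index)
    next
      case False
      then have less: "i < j" using ij by simp
      consider "k = i" "l = j" | "k = i" "l \<noteq> j" | "k \<noteq> i" "l = j" | "k \<noteq> i" "l \<noteq> j" by blast
      then show ?thesis
      proof cases
        case 1
        \<comment> \<open>The required value is \<open>V $$ (i, i) - V $$ (j, j)\<close>, which is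
          the cocycle relation based at 0. For \<open>i = 0\<close> that relation is replaced by
          \<open>d 0 0 0 0 = 0\<close>.\<close>
        then show ?thesis
          using less ij d_cocycle[of 0 i j] d_diag[of 0] by (cases "i = 0") (auto simp: V_index)
      next
        case 2
        then show ?thesis
          using less ij kl d_right[of i j k l] d_swap[of j l] by (auto simp: V_index)
      next
        case 3
        then show ?thesis
          using less ij kl d_left[of i j k l] by (auto simp: V_index)
      next
        case 4
        have "d i j k l = 0"
        \<comment> \<open>For \<open>l = i\<close>, \<open>d_left\<close> is a tautology and
          \<open>d_right\<close> decides. At position \<open>(j, i)\<close> both are tautologies,
          but that entry lies below the diagonal.\<close>
        proof (cases "l = i")
          case True
          then show ?thesis
            using less ij kl 4 d_right[of i j k l] d_lower[of i j l k] by (cases "k = j") auto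
        next
          case False
          then show ?thesis
            using less ij kl 4 d_left[of i j k l] by auto
        qed
        then show ?thesis
          using 4 by simp
      qed
    qed
    then show "D (?E i j) $$ (k, l) = (V * ?E i j - ?E i j * V) $$ (k, l)"
      by (simp only: rhs d_def)
  qed (use DE[of i j] ij V in auto)
  have "D A = V * A - A * V" if "A \<in> ?T" for A
  proof (rule linear_self_map_eqI[OF lin _ _ _ D_unit that])
    show "V * 0\<^sub>m n n - 0\<^sub>m n n * V = 0\<^sub>m n n"
      using V by (intro eq_matI) auto
    show "V * (A + B) - (A + B) * V = (V * A - A * V) + (V * B - B * V)"
      if "A \<in> carrier_mat n n" "B \<in> carrier_mat n n" for A B
      using that V by (intro eq_matI)
        (simp_all add: add_mult_distrib_mat[where nr = n and n = n and nc = n]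
          mult_add_distrib_mat[where nr = n and n = n and nc = n] del: index_mult_mat(1))
    show "V * (c \<cdot>\<^sub>m A) - (c \<cdot>\<^sub>m A) * V = c \<cdot>\<^sub>m (V * A - A * V)"
      if "A \<in> carrier_mat n n" for c A
      using that V by (intro eq_matI)
        (simp_all add: mult_smult_distrib[where nr = n and n = n and nc = n]
          mult_smult_assoc_mat[where nr = n and n = n and nc = n] right_diff_distrib
          del: index_mult_mat(1))
  qed
  with V show ?thesis
    by (rule that)
qed

theorem theorem2p1:
  fixes n :: nat
    and D :: "'a::comm_ring_1 mat \<Rightarrow> 'a mat"
  assumes "n \<ge> 2"
    and "jordan_derivation (upper_triangular_mats n) D"
  shows "derivation (upper_triangular_mats n) D"
proof -
  obtain V where V: "V \<in> carrier_mat n n"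
    and inner: "\<And>A. A \<in> upper_triangular_mats n \<Longrightarrow> D A = V * A - A * V"
    using assms(2) by (rule jordan_derivation_inner) blast
  have "D (A * B) = D A * B + A * D B"
    if A: "A \<in> upper_triangular_mats n" and B: "B \<in> upper_triangular_mats n" for A B
  proof -
    note carr = V A[THEN upper_triangular_mats_carrier] B[THEN upper_triangular_mats_carrier]
    \<comment> \<open>On the right the two products \<open>A * V * B\<close> cancel: every
      commutator map satisfies the Leibniz rule.\<close>
    have "V * (A * B) - (A * B) * V = (V * A - A * V) * B + A * (V * B - B * V)"
      using carr by (intro eq_matI)
        (simp_all add: minus_mult_distrib_mat[where nr = n and n = n and nc = n]
          mult_minus_distrib_mat[where nr = n and n = n and nc = n]
          assoc_mult_mat[where n\<^sub>1 = n and n\<^sub>2 = n and n\<^sub>3 = n and n\<^sub>4 = n] del: index_mult_mat(1))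
    then show ?thesis
      by (simp add: inner A B upper_triangular_mats_mult)
  qed
  with assms(2) show ?thesis
    by (simp add: derivation_def jordan_derivation_def)
qed

end
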